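(* For all $n,k\in\mathbb{Z}$, $R_{n,k}=b_k(n)$, where $R_{n,k}$ is the Rascal number and $b_k(n)$ is the number of binary words of length $n$ with exactly $k$ 1's and at most 1 ascent.
   Context: The Rascal numbers $R_{n,k}$ ($n,k\in\mathbb{Z}$) are defined by: $R_{n,k}=0$ whenever $k>n$, $n<0$, or $k<0$; $R_{n,0}=R_{n,n}=1$ for all $n\ge 0$; and $R_{n,k}=\dfrac{R_{n-1,k}R_{n-1,k-1}+1}{R_{n-2,k-1}}$ for $n\ge 2$ and $1\le k\le n-1$. A binary word of length $n$ is a string $w=w_1w_2\cdots w_n$ with each $w_i\in\{0,1\}$. Its ascent number $\operatorname{asc}(w)$ is the number of indices $1\le i\le n-1$ with $w_i<w_{i+1}$. The only word of length $0$ is the empty word, which has ascent number $0$; there are no words of negative length. $B_k(n)$ denotes the set of binary words of length $n$ with exactly $k$ 1's and at most 1 ascent (so it is empty if $n<0$, $k<0$, or $k>n$), and $b_k(n)=|B_k(n)|$. *)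

theory Defs
  imports Complex_Main
begin

text \<open>
  The recurrence divides, so the Rascal numbers are taken in the rationals. In the last
  branch we have \<open>0 < k < n\<close>, i.e. \<open>n \<ge> 2\<close> and \<open>1 \<le> k \<le> n - 1\<close>.
\<close>

function rascal :: "int \<Rightarrow> int \<Rightarrow> rat" where
  "rascal n k =
     (if k > n \<or> n < 0 \<or> k < 0 then 0
      else if k = 0 \<or> k = n then 1
      else (rascal (n - 1) k * rascal (n - 1) (k - 1) + 1) / rascal (n - 2) (k - 1))"
  by auto
termination
  by (relation "measure (\<lambda>(n, k). nat n)") auto

text \<open>The unconditional equation loops as a simplification rule.\<close>

declare rascal.simps [simp del]

lemma rascal_outside: "k > n \<or> n < 0 \<or> k < 0 \<Longrightarrow> rascal n k = 0"
  by (subst rascal.simps) simp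

lemma rascal_boundary: "n \<ge> 0 \<Longrightarrow> rascal n 0 = 1" "n \<ge> 0 \<Longrightarrow> rascal n n = 1"
  by (subst rascal.simps, simp)+

lemma rascal_rec:
  assumes "n \<ge> 2" "1 \<le> k" "k \<le> n - 1"
  shows "rascal n k =
    (rascal (n - 1) k * rascal (n - 1) (k - 1) + 1) / rascal (n - 2) (k - 1)"
  using assms by (subst rascal.simps) simp

text \<open>Letters are indexed from 0.\<close>

definition asc :: "nat list \<Rightarrow> nat" where
  "asc w = card {i. i + 1 < length w \<and> w ! i < w ! (i + 1)}"

definition B :: "int \<Rightarrow> int \<Rightarrow> nat list set" where
  "B k n = {w. set w \<subseteq> {0, 1} \<and> int (length w) = n \<and> int (count_list w 1) = k \<and> asc w \<le> 1}"

lemma finite_B: "finite (B k n)"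
proof (rule finite_subset)
  show "B k n \<subseteq> {w. set w \<subseteq> {0, 1} \<and> length w = nat n}"
    by (auto simp: B_def)
  show "finite {w. set w \<subseteq> {0, 1::nat} \<and> length w = nat n}"
    by (rule finite_lists_length_eq) simp
qed

definition b :: "int \<Rightarrow> int \<Rightarrow> nat" where
  "b k n = card (B k n)"

end

theory Submission
  imports Defs
begin

text \<open>
  Both sides equal \<open>z * k + 1\<close>, where \<open>z = n - k\<close> is the number of zeros. For the Rascal numbers
  this is an induction on the recurrence. For the words, fix \<open>k \<ge> 1\<close>: a leading 1 can be deleted
  without changing the ascent number, while the words with a leading 0 are exactly
  \<open>0\<^sup>c\<^sup>+\<^sup>1 1\<^sup>k 0\<^sup>e\<close> with \<open>c + 1 + e = z\<close>, of which there are \<open>z\<close>. Hence passing from \<open>k - 1\<close> to \<open>k\<close> adds \<open>z\<close>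
  words.
\<close>

lemma rascal_add: "rascal (int z + int k) (int k) = of_nat (z * k + 1)"
proof (induction "z + k" arbitrary: z k rule: less_induct)
  case less
  show ?case
  proof (cases "z = 0 \<or> k = 0")
    case True
    then show ?thesis by (auto simp: rascal_boundary)
  next
    case False
    then obtain x y where zk: "z = Suc x" "k = Suc y"
      by (meson not0_implies_Suc)
    have "rascal (int x + int k) (int k) = of_nat (x * k + 1)"
      and "rascal (int z + int y) (int y) = of_nat (z * y + 1)"
      and "rascal (int x + int y) (int y) = of_nat (x * y + 1)"
      by (rule less; simp add: zk)+
    then have "rascal (int z + int k) (int k) =
        (of_nat (x * k + 1) * of_nat (z * y + 1) + 1) / of_nat (x * y + 1)"
      using rascal_rec[of "int z + int k" "int k"] zk by (simp add: algebra_simps)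
    \<comment> \<open>With \<open>z = x + 1\<close> and \<open>k = y + 1\<close>, expanding both
      sides reduces this to \<open>x * k + z * y + 1 = z * k + x * y\<close>, so the division is
      exact.\<close>
    also have "of_nat (x * k + 1) * of_nat (z * y + 1) + (1::rat) =
        of_nat (z * k + 1) * of_nat (x * y + 1)"
      by (simp add: zk algebra_simps)
    also have "\<dots> / of_nat (x * y + 1) = (of_nat (z * k + 1) :: rat)"
      by (rule nonzero_mult_div_cancel_right) (simp only: of_nat_eq_0_iff)
    finally show ?thesis .
  qed
qed

lemma asc_Nil [simp]: "asc [] = 0"
  by (simp add: asc_def)

lemma asc_single [simp]: "asc [x] = 0"
  by (simp add: asc_def)

text \<open>Position 0 is split off and all later ascents shift by one. This turns the positional
  definition into a recursion suited to list induction.\<close>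

lemma asc_Cons_Cons [simp]:
  "asc (x # y # w) = (if x < y then Suc (asc (y # w)) else asc (y # w))"
proof -
  let ?A = "\<lambda>w. {i. i + 1 < length w \<and> w ! i < w ! (i + 1)}"
  have "?A (x # y # w) = (if x < y then {0} else {}) \<union> Suc ` ?A (y # w)"
    by (rule set_eqI, case_tac xa) (auto simp: image_iff)
  moreover have "finite (?A (y # w))"
    by (rule finite_subset[of _ "{..<length (y # w)}"]) auto
  ultimately show ?thesis
    by (simp add: asc_def card_image del: One_nat_def)
qed

lemma asc_one_Cons [simp]: "set w \<subseteq> {0, Suc 0} \<Longrightarrow> asc (Suc 0 # w) = asc w"
  by (cases w) auto

lemma asc_zeros: "asc (replicate c 0) = 0"
  by (induction c) (auto simp: asc_def nth_Cons')

lemma asc_ones_zeros: "asc (replicate k 1 @ replicate c 0) = 0"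
proof (induction k)
  case (Suc k)
  have "set (replicate k 1 @ replicate c 0) \<subseteq> {0, Suc 0}" by auto
  then show ?case using Suc by simp
qed (simp add: asc_zeros)

text \<open>Only the passage from the first zero block to the ones can be an ascent.\<close>

lemma asc_zeros_ones_zeros: "asc (replicate c 0 @ replicate k 1 @ replicate e 0) \<le> 1"
proof (induction c)
  case 0
  then show ?case using asc_ones_zeros[of k e] by simp
next
  case (Suc c)
  show ?case
  proof (cases c)
    case 0
    then show ?thesis
      using asc_ones_zeros[of k e] asc_zeros[of "Suc e"]
      by (cases k) auto
  next
    case (Suc d)
    then show ?thesis using Suc.IH by simp
  qed
qed

text \<open>Without ascents the letters are weakly decreasing, so every 1 precedes every 0.\<close>

lemma asc_eq_0D:
  assumes "set w \<subseteq> {0, 1}" "asc w = 0"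
  shows "w = replicate (count_list w 1) 1 @ replicate (count_list w 0) 0"
  using assms
proof (induction w)
  case (Cons x w)
  show ?case
  proof (cases "x = 1")
    case True
    then show ?thesis using Cons asc_one_Cons[of w] by auto
  next
    case False
    then have x: "x = 0" using Cons.prems by auto
    have "asc w = 0" "w = [] \<or> hd w = 0"
      using Cons.prems x by (cases w; auto split: if_splits)+
    then have w: "w = replicate (count_list w 1) 1 @ replicate (count_list w 0) 0"
      using Cons by simp
    have "count_list w 1 = 0"
    proof (rule ccontr)
      assume nz: "count_list w 1 \<noteq> 0"
      then have "hd w = 1" by (subst w) (simp add: hd_append)
      with nz \<open>w = [] \<or> hd w = 0\<close> show False by auto
    qed
    then show ?thesis using w x by simp
  qed
qed simp

text \<open>The 0 in front guarantees an ascent into the first 1 of \<open>w\<close>. Nothing is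
  left for the remainder, which \<open>asc_eq_0D\<close> then describes; \<open>c\<close> counts the
  zeros before that 1.\<close>

lemma asc_zero_Cons_le_1D:
  assumes "set w \<subseteq> {0, 1}" "asc (0 # w) \<le> 1" "1 \<in> set w"
  shows "\<exists>c\<le>count_list w 0. w =
    replicate c 0 @ replicate (count_list w 1) 1 @ replicate (count_list w 0 - c) 0"
  using assms
proof (induction w)
  case (Cons x w)
  show ?case
  proof (cases "x = 1")
    case True
    then have "asc (x # w) = 0" using Cons.prems by simp
    then have "x # w = replicate 0 0 @ replicate (count_list (x # w) 1) 1 @
        replicate (count_list (x # w) 0 - 0) 0"
      unfolding replicate_0 append_Nil diff_zero by (rule asc_eq_0D[OF Cons.prems(1)])
    then show ?thesis by blast
  next
    case False
    then have x: "x = 0" using Cons.prems by auto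
    then obtain c where c: "c \<le> count_list w 0" and
      w: "w = replicate c 0 @ replicate (count_list w 1) 1 @ replicate (count_list w 0 - c) 0"
      using Cons by auto
    have "x # w = replicate (Suc c) 0 @ replicate (count_list (x # w) 1) 1 @
        replicate (count_list (x # w) 0 - Suc c) 0"
      by (subst w) (simp add: x)
    moreover have "Suc c \<le> count_list (x # w) 0" using c x by simp
    ultimately show ?thesis by blast
  qed
qed simp

text \<open>Counting zeros instead of the length keeps \<open>z\<close> fixed when a leading 1 is
  deleted, which permits induction on \<open>k\<close> alone.\<close>

definition words :: "nat \<Rightarrow> nat \<Rightarrow> nat list set" where
  "words z k = {w. set w \<subseteq> {0, 1} \<and> count_list w 0 = z \<and> count_list w 1 = k \<and> asc w \<le> 1}"

lemma length_eq_count_list_01: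
  "set w \<subseteq> {0, 1} \<Longrightarrow> length w = count_list w 0 + count_list w (1::nat)"
  by (induction w) auto

lemma B_eq_words: "B (int k) (int z + int k) = words z k"
  by (auto simp: B_def words_def length_eq_count_list_01)

lemma count_list_replicate: "count_list (replicate m x) y = (if x = y then m else 0)"
  by (induction m) auto

lemma words_no_ones: "words z 0 = {replicate z 0}"
proof -
  have "w = replicate z 0" if "w \<in> words z 0" for w
  proof -
    from that have "set w \<subseteq> {0}" "length w = z"
      using length_eq_count_list_01[of w] by (auto simp: words_def count_list_0_iff)
    then show ?thesis by (auto intro: replicate_eqI)
  qed
  then show ?thesis
    by (auto simp: words_def count_list_replicate asc_zeros)
qed

lemma words_Suc:
  "words z (Suc k) = (#) 1 ` words z k \<union>
    (\<lambda>c. replicate (Suc c) 0 @ replicate (Suc k) 1 @ replicate (z - Suc c) 0) ` {..<z}"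
    (is "_ = ?ones \<union> ?f ` _")
proof (intro equalityI subsetI)
  fix w assume w: "w \<in> words z (Suc k)"
  then obtain x v where xv: "w = x # v" by (cases w) (auto simp: words_def)
  show "w \<in> ?ones \<union> ?f ` {..<z}"
  proof (cases "x = 1")
    case True
    then show ?thesis using w xv asc_one_Cons[of v] by (auto simp: words_def)
  next
    case False
    then have x: "x = 0" and v: "set v \<subseteq> {0, 1}" "asc (0 # v) \<le> 1" "count_list v 1 = Suc k"
      and z: "z = Suc (count_list v 0)"
      using w xv by (auto simp: words_def)
    have "1 \<in> set v" using v(3) by (metis count_notin nat.distinct(1))
    then obtain c where "c \<le> count_list v 0"
      "v = replicate c 0 @ replicate (Suc k) 1 @ replicate (count_list v 0 - c) 0"
      using asc_zero_Cons_le_1D[of v] v by auto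
    \<comment> \<open>Restoring the leading 0 lengthens the first zero block of \<open>v\<close>
      from \<open>c\<close> to \<open>Suc c\<close>.\<close>
    then have "c < z" "w = ?f c" using x xv z by auto
    then show ?thesis by blast
  qed
next
  fix w assume "w \<in> ?ones \<union> ?f ` {..<z}"
  then show "w \<in> words z (Suc k)"
  proof
    assume "w \<in> ?ones"
    then show ?thesis using asc_one_Cons by (auto simp: words_def)
  next
    assume "w \<in> ?f ` {..<z}"
    then obtain c where c: "c < z" "w = ?f c" by blast
    then have "asc w \<le> 1" by (simp only: asc_zeros_ones_zeros)
    then show ?thesis
      using c unfolding words_def by (auto simp: count_list_replicate)
  qed
qed

lemma card_words: "finite (words z k) \<and> card (words z k) = z * k + 1"
proof (induction k)
  case 0
  then show ?case by (simp add: words_no_ones)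
next
  case (Suc k)
  let ?f = "\<lambda>c. replicate (Suc c) 0 @ replicate (Suc k) 1 @ replicate (z - Suc c) (0::nat)"
  have "inj ?f"
  proof (rule injI)
    fix c d assume "?f c = ?f d"
    \<comment> \<open>The initial zeros stop at a 1, since the block of ones has length
      \<open>Suc k\<close>; their number \<open>Suc c\<close> thus determines
      \<open>c\<close>.\<close>
    then have "takeWhile (\<lambda>x. x = 0) (?f c) = takeWhile (\<lambda>x. x = 0) (?f d)" by simp
    then show "c = d" by (simp add: takeWhile_append)
  qed
  then have "card (?f ` {..<z}) = z" by (simp add: card_image inj_on_subset)
  moreover have "card ((#) 1 ` words z k) = z * k + 1"
    using Suc by (simp add: card_image)
  \<comment> \<open>The first letters differ, as the zero block has length \<open>Suc c\<close> and
    is never empty.\<close>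
  moreover have "(#) 1 ` words z k \<inter> ?f ` {..<z} = {}" by auto
  ultimately show ?case
    unfolding words_Suc using Suc by (subst card_Un_disjoint) auto
qed

theorem theorem1:
  fixes n k :: int
  shows "rascal n k = of_nat (b k n)"
proof (cases "0 \<le> k \<and> k \<le> n")
  case True
  define z m where "z = nat (n - k)" and "m = nat k"
  have "n = int z + int m" "k = int m" using True by (auto simp: z_def m_def)
  then show ?thesis using card_words[of z m] by (simp add: rascal_add b_def B_eq_words)
next
  case False
  \<comment> \<open>A length or a count would be negative, or the ones would outnumber the
    letters.\<close>
  have "B k n = {}"
    using False count_le_length by (fastforce simp: B_def)
  then show ?thesis using False by (auto simp: b_def intro!: rascal_outside)
qed

end
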